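(* Let $D$ be a convex domain in $H_1$ with boundary $\Sigma:=\partial D$. Suppose $\gamma(s)$ is an oriented horizontal line $G_{p,\theta,t}$ intersecting $D$, with chord length $\sigma$ with respect to the Levi metric. Then $$\int_{\forall G,\ G\cap D\neq\emptyset}\sigma\, dG \;=\; 2\pi\, V(D),$$ where $dG=dp\wedge d\theta\wedge dt$ is the density of the horizontal lines and $V(D)$ is the Lebesgue volume of $D$ in $\mathbb{R}^3$.
   Context: The 3D-Heisenberg group $H_1$ is $\mathbb{R}^3$ with coordinates $(x,y,t)$ and group law $(a,b,c)\circ(x,y,t)=(a+x,\,b+y,\,c+t+bx-ay)$. Put $\mathring e_1=\partial_x+y\,\partial_t$, $\mathring e_2=\partial_y-x\,\partial_t$, $T=\partial_t$. The contact plane field is $\xi=\mathrm{span}\{\mathring e_1,\mathring e_2\}=\ker\Theta$, where $\Theta=dt+x\,dy-y\,dx$. The CR structure $J$ on $\xi$ is given by $J\mathring e_1=\mathring e_2$, $J\mathring e_2=-\mathring e_1$. The Levi metric on $\xi$ is $\frac12 d\Theta(X,JY)$, for which $\mathring e_1,\mathring e_2$ are orthonormal. The volume is $V(D)=\frac12\int_D\Theta\wedge d\Theta$, which equals the Lebesgue volume of $D$. A horizontal line is a straight line in $\mathbb{R}^3$ whose velocity vector is always tangent to the contact plane. Every horizontal line $G$ is represented uniquely, up to an orientation, by three parameters $(p,\theta,t)$: $\theta$ ($0\le\theta<2\pi$) is the angle from the positive $x$-axis to the line perpendicular to the projection $\pi(G)$ of $G$ onto the $xy$-plane; $p\ge 0$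 is the distance from the origin to the footpoint $(p\cos\theta,p\sin\theta,0)\in\pi(G)$; and $t\in\mathbb{R}$ is the height of the base point $B=(p\cos\theta,p\sin\theta,t)\in G$ lying over the footpoint. The line is denoted $G_{p,\theta,t}$ and is parametrized by $$\gamma(s)=(p\cos\theta+s\sin\theta,\;p\sin\theta-s\cos\theta,\;t+sp),$$ where $s$ is arc length for the Levi metric. The length of the part of a horizontal line between $\gamma(s_0)$ and $\gamma(s_1)$ is $\int_{s_0}^{s_1}|\gamma'(s)|\,ds$, with $|\cdot|$ the Levi norm; $\sigma$ is this length for the chord $G\cap D$. The density $dG=dp\wedge d\theta\wedge dt$ is always taken in absolute value. *)

theory Defs
  imports "HOL-Analysis.Analysis"
begin

type_synonym heis = "real \<times> real \<times> real"

definition heis_e1 :: "heis \<Rightarrow> heis" where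
  "heis_e1 = (\<lambda>(x, y, t). (1, 0, y))"

definition heis_e2 :: "heis \<Rightarrow> heis" where
  "heis_e2 = (\<lambda>(x, y, t). (0, 1, - x))"

definition contact_plane :: "heis \<Rightarrow> heis set" where
  "contact_plane q = span {heis_e1 q, heis_e2 q}"

text \<open>The form \<open>\<Theta> = dt + x dy - y dx\<close> at a point, applied to a tangent vector.\<close>

definition contact_form :: "heis \<Rightarrow> heis \<Rightarrow> real" where
  "contact_form = (\<lambda>(x, y, t) (a, b, c). c + x * b - y * a)"

text \<open>\<open>d\<Theta> = 2 dx \<and> dy\<close>, which does not depend on the base point.\<close>

definition d_contact_form :: "heis \<Rightarrow> heis \<Rightarrow> real" where
  "d_contact_form = (\<lambda>(a, b, c) (a', b', c'). 2 * (a * b' - b * a'))"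

text \<open>A vector of the contact plane with first two components \<open>a, b\<close> is
  \<open>a e\<^sub>1 + b e\<^sub>2\<close>, which \<open>J\<close> maps to \<open>a e\<^sub>2 - b e\<^sub>1\<close>. \<open>CR_J\<close> and the Levi metric are
  meaningful only on the contact plane at the given point; outside it they are junk.\<close>

definition CR_J :: "heis \<Rightarrow> heis \<Rightarrow> heis" where
  "CR_J q = (\<lambda>(a, b, c). a *\<^sub>R heis_e2 q - b *\<^sub>R heis_e1 q)"

definition levi_metric :: "heis \<Rightarrow> heis \<Rightarrow> heis \<Rightarrow> real" where
  "levi_metric q u v = 1 / 2 * d_contact_form u (CR_J q v)"

definition levi_norm :: "heis \<Rightarrow> heis \<Rightarrow> real" where
  "levi_norm q v = sqrt (levi_metric q v v)"

definition horizontal_line :: "heis set \<Rightarrow> bool" where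
  "horizontal_line G \<longleftrightarrow> (\<exists>q v. v \<noteq> 0 \<and> G = range (\<lambda>s. q + s *\<^sub>R v) \<and>
     (\<forall>s. v \<in> contact_plane (q + s *\<^sub>R v)))"

definition line_curve :: "real \<times> real \<times> real \<Rightarrow> real \<Rightarrow> heis" where
  "line_curve = (\<lambda>(p, \<theta>, t) s.
     (p * cos \<theta> + s * sin \<theta>, p * sin \<theta> - s * cos \<theta>, t + s * p))"

definition line_params :: "(real \<times> real \<times> real) set" where
  "line_params = {(p, \<theta>, t). 0 \<le> p \<and> 0 \<le> \<theta> \<and> \<theta> < 2 * pi}"

text \<open>The parameters \<open>(p, \<theta>, t)\<close> describe a horizontal line only up to orientation. An
  oriented line is \<open>(\<epsilon>, p, \<theta>, t)\<close> with \<open>\<epsilon> \<in> {1, -1}\<close>, where \<open>\<epsilon> = -1\<close> stands for the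
  line traversed backwards.\<close>

definition oriented_line :: "real \<times> (real \<times> real \<times> real) \<Rightarrow> real \<Rightarrow> heis" where
  "oriented_line = (\<lambda>(\<epsilon>, P) s. line_curve P (\<epsilon> * s))"

text \<open>The density \<open>dG = |dp \<and> d\<theta> \<and> dt|\<close> on the set of oriented horizontal lines: it is
  Lebesgue measure in \<open>(p, \<theta>, t)\<close> for each of the two orientations. Equivalently, it is
  \<open>dp d\<theta> dt\<close> for a signed distance \<open>p \<in> \<real>\<close>, since \<open>(-p, \<theta> + \<pi>, t)\<close> is the line
  \<open>(p, \<theta>, t)\<close> with reversed orientation.\<close>

definition line_density :: "(real \<times> (real \<times> real \<times> real)) measure" where
  "line_density = count_space {1, -1} \<Otimes>\<^sub>M restrict_space lborel line_params"

text \<open>For open convex \<open>D\<close> and a straight line \<open>\<gamma>\<close>, the set \<open>{s. \<gamma> s \<in> D}\<close> is an open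
  interval \<open>(s\<^sub>0, s\<^sub>1)\<close>, so this is the Levi length of \<open>\<gamma>\<close> between \<open>s\<^sub>0\<close> and \<open>s\<^sub>1\<close>,
  possibly infinite if \<open>D\<close> is unbounded.\<close>

definition chord_length :: "heis set \<Rightarrow> (real \<Rightarrow> heis) \<Rightarrow> ennreal" where
  "chord_length D \<gamma> =
     (\<integral>\<^sup>+s\<in>{s. \<gamma> s \<in> D}. ennreal (levi_norm (\<gamma> s) (vector_derivative \<gamma> (at s))) \<partial>lborel)"

lemma contact_plane_eq_kernel: "contact_plane q = {v. contact_form q v = 0}"
proof -
  obtain x y t where q: "q = (x, y, t)" by (cases q)
  have "v \<in> span {heis_e1 q, heis_e2 q} \<longleftrightarrow> contact_form q v = 0" for v
  proof -
    obtain a b c where v: "v = (a, b, c)" by (cases v)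
    have "v \<in> span {heis_e1 q, heis_e2 q} \<longleftrightarrow>
        (\<exists>k l. v - k *\<^sub>R heis_e1 q = l *\<^sub>R heis_e2 q)"
      by (auto simp: span_breakdown_eq span_singleton)
    also have "\<dots> \<longleftrightarrow> contact_form q v = 0"
      by (auto simp: q v heis_e1_def heis_e2_def contact_form_def algebra_simps)
    finally show ?thesis .
  qed
  then show ?thesis by (auto simp: contact_plane_def)
qed

lemma line_curve_altdef:
  "line_curve (p, \<theta>, t) s = (p * cos \<theta>, p * sin \<theta>, t) + s *\<^sub>R (sin \<theta>, - cos \<theta>, p)"
  by (simp add: line_curve_def algebra_simps)

lemma line_direction_in_contact_plane:
  "(sin \<theta>, - cos \<theta>, p) \<in> contact_plane (line_curve (p, \<theta>, t) s)"
proof -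
  have "p - (p * (sin \<theta>)\<^sup>2 + p * (cos \<theta>)\<^sup>2) = 0"
    by (simp flip: distrib_left)
  then show ?thesis
    by (simp add: contact_plane_eq_kernel contact_form_def line_curve_def
        algebra_simps power2_eq_square)
qed

text \<open>The parameters in \<open>line_params\<close> describe exactly the horizontal lines.\<close>

lemma horizontal_line_iff: "horizontal_line G \<longleftrightarrow> (\<exists>P\<in>line_params. G = range (line_curve P))"
proof
  assume "\<exists>P\<in>line_params. G = range (line_curve P)"
  then obtain p \<theta> t where G: "G = range (line_curve (p, \<theta>, t))"
    by auto
  have "(sin \<theta>, - cos \<theta>, p) \<noteq> 0"
    using sin_zero_abs_cos_one[of \<theta>] by (auto simp: zero_prod_def)
  moreover have "G = range (\<lambda>s. (p * cos \<theta>, p * sin \<theta>, t) + s *\<^sub>R (sin \<theta>, - cos \<theta>, p))"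
    unfolding G line_curve_altdef ..
  ultimately show "horizontal_line G"
    using line_direction_in_contact_plane[of \<theta> p t]
    unfolding horizontal_line_def line_curve_altdef by blast
next
  assume "horizontal_line G"
  then obtain q v where v0: "v \<noteq> 0" and G: "G = range (\<lambda>s. q + s *\<^sub>R v)"
    and hor: "v \<in> contact_plane (q + 0 *\<^sub>R v)"
    unfolding horizontal_line_def by blast
  obtain a b c where q: "q = (a, b, c)" by (cases q)
  obtain u w z where v: "v = (u, w, z)" by (cases v)
  have z: "z = b * u - a * w"
    using hor by (simp add: contact_plane_eq_kernel contact_form_def q v)
  define n where "n = sqrt (u\<^sup>2 + w\<^sup>2)"
  have uw: "u \<noteq> 0 \<or> w \<noteq> 0"
    using v0 z by (auto simp: v zero_prod_def)
  then have n: "n > 0" and n2: "n\<^sup>2 = u\<^sup>2 + w\<^sup>2"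
    by (auto simp: n_def sum_power2_gt_zero_iff)
  define l where "l = (if b * u - a * w \<ge> 0 then n else - n)"
  have l0: "l \<noteq> 0" and l2: "l\<^sup>2 = u\<^sup>2 + w\<^sup>2"
    using n n2 by (auto simp: l_def)
  have "(- w / l)\<^sup>2 + (u / l)\<^sup>2 = (u\<^sup>2 + w\<^sup>2) / l\<^sup>2"
    by (simp add: power_divide add_divide_distrib)
  also have "\<dots> = 1" using l0 by (simp flip: l2)
  finally obtain \<theta> where th: "0 \<le> \<theta>" "\<theta> < 2 * pi" "- w / l = cos \<theta>" "u / l = sin \<theta>"
    by (rule sincos_total_2pi)
  have u': "u = l * sin \<theta>" and w': "w = - (l * cos \<theta>)"
    using th(3,4) l0 by (auto simp: field_simps)
  define p where "p = a * cos \<theta> + b * sin \<theta>"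
  have lp: "b * u - a * w = l * p"
    by (simp add: p_def u' w' algebra_simps)
  have p: "p \<ge> 0"
  proof (rule ccontr)
    assume "\<not> p \<ge> 0"
    then have "n * p < 0" using n by (simp add: mult_pos_neg)
    then show False using lp by (auto simp: l_def split: if_splits)
  qed
  define s0 where "s0 = a * sin \<theta> - b * cos \<theta>"
  define t where "t = c - s0 * p"
  have "p * cos \<theta> + s0 * sin \<theta> = a * ((sin \<theta>)\<^sup>2 + (cos \<theta>)\<^sup>2)"
    by (simp only: p_def s0_def power2_eq_square) (simp only: algebra_simps)
  then have 1: "p * cos \<theta> + s0 * sin \<theta> = a" by simp
  have "p * sin \<theta> - s0 * cos \<theta> = b * ((sin \<theta>)\<^sup>2 + (cos \<theta>)\<^sup>2)"
    unfolding p_def s0_def power2_eq_square by algebra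
  then have 2: "p * sin \<theta> - s0 * cos \<theta> = b" by simp
  have line: "q + s *\<^sub>R v = line_curve (p, \<theta>, t) (s0 + l * s)" for s
    using 1 2 lp by (simp add: q v z line_curve_def t_def u' w' algebra_simps)
  have "surj (\<lambda>s. s0 + l * s)"
    using l0 by (intro surjI[of _ "\<lambda>s. (s - s0) / l"]) simp
  then have "range (line_curve (p, \<theta>, t) \<circ> (\<lambda>s. s0 + l * s)) = range (line_curve (p, \<theta>, t))"
    by (simp only: image_comp[symmetric])
  then have "G = range (line_curve (p, \<theta>, t))"
    by (simp add: G line o_def)
  moreover have "(p, \<theta>, t) \<in> line_params"
    using p th by (simp add: line_params_def)
  ultimately show "\<exists>P\<in>line_params. G = range (line_curve P)" by blast
qed

end

theory Submission
  imports Defs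
begin

text \<open>
  For a fixed direction \<open>\<theta>\<close>, the map
  \<open>(p, s, t) \<mapsto> (p cos \<theta> + s sin \<theta>, p sin \<theta> - s cos \<theta>, t + s p)\<close>, which sends the parameter
  \<open>s\<close> on the line \<open>(p, \<theta>, t)\<close> to its point in space, preserves volume: at fixed \<open>(p, s)\<close> it
  translates the height \<open>t\<close> (\<open>nn_integral_vertical_plane\<close>), and it acts on \<open>(p, s)\<close> by an
  orthogonal matrix (\<open>nn_integral_orthogonal_plane\<close>). An oriented
  horizontal line \<open>\<gamma>\<close> has unit Levi speed, so its chord length is the one-dimensional measure
  of the parameters \<open>s\<close> with \<open>\<gamma> s \<in> D\<close>, and lines that miss \<open>D\<close> contribute nothing.
  By Tonelli's theorem, integrating chord lengths over \<open>p\<close> and \<open>t\<close> at fixed \<open>\<theta>\<close> therefore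
  gives the volume of a part of \<open>D\<close>. Because \<open>p \<ge> 0\<close>, this part lies over the half-plane
  \<open>x cos \<theta> + y sin \<theta> \<ge> 0\<close>; the directions \<open>\<theta>\<close> and \<open>\<theta> + \<pi>\<close> give complementary
  half-planes (\<open>half_plane_integral_opposite\<close>). Each pair of opposite directions thus
  contributes \<open>V(D)\<close>, and \<open>\<theta> \<in> [0, \<pi>)\<close> runs through all pairs: the lines without
  orientation contribute \<open>\<pi> V(D)\<close>. The two orientations have equal chords, whence \<open>2 \<pi> V(D)\<close>.
\<close>

lemma levi_norm_horizontal: "levi_norm q (a, b, c) = sqrt (a\<^sup>2 + b\<^sup>2)"
  by (cases q) (simp add: levi_norm_def levi_metric_def d_contact_form_def CR_J_def
      heis_e1_def heis_e2_def power2_eq_square algebra_simps)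

lemma oriented_line_has_vector_derivative:
  "(oriented_line (\<epsilon>, p, \<theta>, t) has_vector_derivative (\<epsilon> * sin \<theta>, - \<epsilon> * cos \<theta>, \<epsilon> * p)) (at s)"
  unfolding oriented_line_def line_curve_def prod.case
  by (auto intro!: has_vector_derivative_Pair derivative_eq_intros
      simp flip: has_real_derivative_iff_has_vector_derivative)

lemma levi_speed_oriented_line:
  assumes "\<epsilon> \<in> {1, -1}"
  shows "levi_norm q (vector_derivative (oriented_line (\<epsilon>, p, \<theta>, t)) (at s)) = 1"
  using assms
  by (auto simp: vector_derivative_at[OF oriented_line_has_vector_derivative]
      levi_norm_horizontal)

lemma line_curve_borel_measurable [measurable]:
  "(\<lambda>(P, s). line_curve P s) \<in> borel_measurable (borel \<Otimes>\<^sub>M borel)"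
  unfolding line_curve_def case_prod_beta borel_prod
  by (intro borel_measurable_continuous_onI continuous_intros)

text \<open>Reversing a line reflects the set of parameters at which it lies in \<open>D\<close>, so the chord
  length depends only on the underlying unoriented line.\<close>

lemma chord_length_oriented_line:
  assumes [measurable]: "D \<in> sets borel" and \<epsilon>: "\<epsilon> \<in> {1, -1}"
  shows "chord_length D (oriented_line (\<epsilon>, P)) = (\<integral>\<^sup>+s. indicator D (line_curve P s) \<partial>lborel)"
proof -
  obtain p \<theta> t where P: "P = (p, \<theta>, t)" by (cases P)
  have "chord_length D (oriented_line (\<epsilon>, P)) = (\<integral>\<^sup>+s. indicator D (line_curve P (0 + \<epsilon> * s)) \<partial>lborel)"
    unfolding chord_length_def P levi_speed_oriented_line[OF \<epsilon>]
    by (intro nn_integral_cong) (simp add: oriented_line_def indicator_def)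
  also have "\<dots> = (\<integral>\<^sup>+s. indicator D (line_curve P s) \<partial>lborel)"
    using \<epsilon> by (subst (2) nn_integral_real_affine[where c = \<epsilon> and t = 0]) auto
  finally show ?thesis .
qed

lemma chord_length_eq_0_if_disjoint:
  assumes "range \<gamma> \<inter> D = {}"
  shows "chord_length D \<gamma> = 0"
proof -
  have "{s. \<gamma> s \<in> D} = {}" using assms by auto
  then show ?thesis by (simp add: chord_length_def)
qed

text \<open>Invariance of planar Lebesgue measure under a reflection across a line through the origin.
  Unless the matrix is diagonal, replacing \<open>s\<close> by the first coordinate \<open>x\<close> gives a factor
  \<open>1 / \<bar>n\<bar>\<close>, which cancels when \<open>p\<close> is then replaced by the second coordinate.\<close>

lemma nn_integral_orthogonal_plane:
  fixes g :: "real \<Rightarrow> real \<Rightarrow> ennreal"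
  assumes [measurable]: "case_prod g \<in> borel_measurable (borel \<Otimes>\<^sub>M borel)"
    and cn: "c\<^sup>2 + n\<^sup>2 = 1"
  shows "(\<integral>\<^sup>+p. \<integral>\<^sup>+s. g (p * c + s * n) (p * n - s * c) \<partial>lborel \<partial>lborel)
       = (\<integral>\<^sup>+x. \<integral>\<^sup>+y. g x y \<partial>lborel \<partial>lborel)"
proof (cases "n = 0")
  case True
  then have c: "c = 1 \<or> c = -1" using cn by (simp add: power2_eq_1_iff)
  have "(\<integral>\<^sup>+y. g x y \<partial>lborel) = (\<integral>\<^sup>+s. g x (0 + (- c) * s) \<partial>lborel)" for x
    using c by (subst nn_integral_real_affine[where c = "- c" and t = 0]) auto
  moreover have "(\<integral>\<^sup>+x. \<integral>\<^sup>+s. g x (- (s * c)) \<partial>lborel \<partial>lborel)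
      = (\<integral>\<^sup>+p. \<integral>\<^sup>+s. g (0 + c * p) (- (s * c)) \<partial>lborel \<partial>lborel)"
    using c by (subst nn_integral_real_affine[where c = c and t = 0]) auto
  ultimately show ?thesis
    using True by (simp add: mult.commute)
next
  case False
  have *: "(p * n - (x - p * c) / n * c) = (p - x * c) / n" for p x
  proof -
    have "p * n * n + p * c * c = p * (c\<^sup>2 + n\<^sup>2)" by (simp add: power2_eq_square algebra_simps)
    then have "p * n * n + p * c * c = p" by (simp add: cn)
    then show ?thesis using False by (simp add: field_simps)
  qed
  have "(\<integral>\<^sup>+s. g (p * c + s * n) (p * n - s * c) \<partial>lborel)
      = (\<integral>\<^sup>+x. ennreal \<bar>1 / n\<bar> * g x ((p - x * c) / n) \<partial>lborel)" for p
  proof -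
    have "(\<integral>\<^sup>+s. g (p * c + s * n) (p * n - s * c) \<partial>lborel) = ennreal \<bar>1 / n\<bar> *
        (\<integral>\<^sup>+x. g (p * c + (- p * c / n + 1 / n * x) * n)
                (p * n - (- p * c / n + 1 / n * x) * c) \<partial>lborel)"
      using False by (intro nn_integral_real_affine) auto
    also have "(\<lambda>x. g (p * c + (- p * c / n + 1 / n * x) * n)
                (p * n - (- p * c / n + 1 / n * x) * c)) = (\<lambda>x. g x ((p - x * c) / n))"
    proof
      fix x
      have "- p * c / n + 1 / n * x = (x - p * c) / n"
        by (simp add: diff_divide_distrib)
      then show "g (p * c + (- p * c / n + 1 / n * x) * n) (p * n - (- p * c / n + 1 / n * x) * c)
          = g x ((p - x * c) / n)"
        using False by (simp only: *) simp
    qed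
    finally show ?thesis by (simp add: nn_integral_cmult)
  qed
  then have "(\<integral>\<^sup>+p. \<integral>\<^sup>+s. g (p * c + s * n) (p * n - s * c) \<partial>lborel \<partial>lborel)
      = (\<integral>\<^sup>+p. \<integral>\<^sup>+x. ennreal \<bar>1 / n\<bar> * g x ((p - x * c) / n) \<partial>lborel \<partial>lborel)"
    by simp
  also have "\<dots> = (\<integral>\<^sup>+x. \<integral>\<^sup>+p. ennreal \<bar>1 / n\<bar> * g x ((p - x * c) / n) \<partial>lborel \<partial>lborel)"
    by (rule lborel_pair.Fubini') measurable
  also have "\<dots> = (\<integral>\<^sup>+x. \<integral>\<^sup>+y. g x y \<partial>lborel \<partial>lborel)"
  proof (rule nn_integral_cong)
    fix x :: real
    have "(\<integral>\<^sup>+p. ennreal \<bar>1 / n\<bar> * g x ((p - x * c) / n) \<partial>lborel)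
        = ennreal \<bar>n\<bar> * (\<integral>\<^sup>+y. ennreal \<bar>1 / n\<bar> * g x ((x * c + n * y - x * c) / n) \<partial>lborel)"
      using False by (intro nn_integral_real_affine) auto
    also have "\<dots> = (ennreal \<bar>n\<bar> * ennreal \<bar>1 / n\<bar>) * (\<integral>\<^sup>+y. g x y \<partial>lborel)"
      using False by (simp add: nn_integral_cmult mult.assoc)
    also have "ennreal \<bar>n\<bar> * ennreal \<bar>1 / n\<bar> = 1"
      using False by (simp add: abs_divide flip: ennreal_mult)
    finally show "(\<integral>\<^sup>+p. ennreal \<bar>1 / n\<bar> * g x ((p - x * c) / n) \<partial>lborel) = (\<integral>\<^sup>+y. g x y \<partial>lborel)"
      by simp
  qed
  finally show ?thesis .
qed

text \<open>This is the integral of \<open>h\<close> over the half-plane \<open>x cos \<theta> + y sin \<theta> \<ge> 0\<close>. It is written in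
  the coordinates \<open>(p, s)\<close> because that is how it arises from the lines.\<close>

definition half_plane_integral :: "(real \<Rightarrow> real \<Rightarrow> ennreal) \<Rightarrow> real \<Rightarrow> ennreal" where
  "half_plane_integral h \<theta> = (\<integral>\<^sup>+p. indicator {0..} p *
     (\<integral>\<^sup>+s. h (p * cos \<theta> + s * sin \<theta>) (p * sin \<theta> - s * cos \<theta>) \<partial>lborel) \<partial>lborel)"

lemma half_plane_integral_measurable [measurable]:
  assumes [measurable]: "case_prod h \<in> borel_measurable (borel \<Otimes>\<^sub>M borel)"
  shows "half_plane_integral h \<in> borel_measurable borel"
  unfolding half_plane_integral_def by measurable

text \<open>Turning by \<open>\<pi>\<close> amounts to changing the signs of \<open>p\<close> and \<open>s\<close>, so the second integral is
  over the half-plane \<open>p \<le> 0\<close> of the first one; the common boundary line is null.\<close>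

lemma half_plane_integral_opposite:
  assumes [measurable]: "case_prod h \<in> borel_measurable (borel \<Otimes>\<^sub>M borel)"
  shows "half_plane_integral h \<theta> + half_plane_integral h (\<theta> + pi)
       = (\<integral>\<^sup>+x. \<integral>\<^sup>+y. h x y \<partial>lborel \<partial>lborel)"
proof -
  define I where "I p = (\<integral>\<^sup>+s. h (p * cos \<theta> + s * sin \<theta>) (p * sin \<theta> - s * cos \<theta>) \<partial>lborel)" for p
  have [measurable]: "I \<in> borel_measurable borel"
    unfolding I_def by measurable
  have I_opp: "(\<integral>\<^sup>+s. h (p * cos (\<theta> + pi) + s * sin (\<theta> + pi)) (p * sin (\<theta> + pi) - s * cos (\<theta> + pi)) \<partial>lborel)
      = I (- p)" for p
    unfolding I_def by (subst (2) nn_integral_real_affine[where c = "-1" and t = 0]) auto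
  have "half_plane_integral h (\<theta> + pi) = (\<integral>\<^sup>+p. indicator {0..} p * I (- p) \<partial>lborel)"
    unfolding half_plane_integral_def I_opp ..
  also have "\<dots> = (\<integral>\<^sup>+p. indicator {..0} p * I p \<partial>lborel)"
    by (subst nn_integral_real_affine[where c = "-1" and t = 0])
      (auto intro!: nn_integral_cong simp: indicator_def)
  finally have "half_plane_integral h \<theta> + half_plane_integral h (\<theta> + pi)
      = (\<integral>\<^sup>+p. indicator {0..} p * I p + indicator {..0} p * I p \<partial>lborel)"
    by (subst nn_integral_add) (auto simp: half_plane_integral_def I_def)
  also have "\<dots> = (\<integral>\<^sup>+p. I p \<partial>lborel)"
    using AE_lborel_singleton[of "0 :: real"]
    by (intro nn_integral_cong_AE) (auto simp: indicator_def elim!: eventually_mono)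
  also have "\<dots> = (\<integral>\<^sup>+x. \<integral>\<^sup>+y. h x y \<partial>lborel \<partial>lborel)"
    unfolding I_def by (rule nn_integral_orthogonal_plane) simp_all
  finally show ?thesis .
qed

lemma half_plane_integral_full_turn:
  assumes [measurable]: "case_prod h \<in> borel_measurable (borel \<Otimes>\<^sub>M borel)"
  shows "(\<integral>\<^sup>+\<theta>. indicator {0..<2 * pi} \<theta> * half_plane_integral h \<theta> \<partial>lborel)
       = ennreal pi * (\<integral>\<^sup>+x. \<integral>\<^sup>+y. h x y \<partial>lborel \<partial>lborel)"
proof -
  let ?H = "half_plane_integral h"
  have "(\<integral>\<^sup>+\<theta>. indicator {0..<2 * pi} \<theta> * ?H \<theta> \<partial>lborel)
      = (\<integral>\<^sup>+\<theta>. indicator {0..<pi} \<theta> * ?H \<theta> + indicator {pi..<2 * pi} \<theta> * ?H \<theta> \<partial>lborel)"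
    using pi_gt_zero by (intro nn_integral_cong) (auto simp: indicator_def simp del: pi_gt_zero)
  also have "\<dots> = (\<integral>\<^sup>+\<theta>. indicator {0..<pi} \<theta> * ?H \<theta> \<partial>lborel)
      + (\<integral>\<^sup>+\<theta>. indicator {pi..<2 * pi} \<theta> * ?H \<theta> \<partial>lborel)"
    by (rule nn_integral_add) auto
  also have "(\<integral>\<^sup>+\<theta>. indicator {pi..<2 * pi} \<theta> * ?H \<theta> \<partial>lborel)
      = (\<integral>\<^sup>+\<theta>. indicator {0..<pi} \<theta> * ?H (\<theta> + pi) \<partial>lborel)"
    by (subst nn_integral_real_affine[where c = 1 and t = pi])
      (auto intro!: nn_integral_cong simp: indicator_def add.commute)
  also have "(\<integral>\<^sup>+\<theta>. indicator {0..<pi} \<theta> * ?H \<theta> \<partial>lborel) + \<dots>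
      = (\<integral>\<^sup>+\<theta>. indicator {0..<pi} \<theta> * (?H \<theta> + ?H (\<theta> + pi)) \<partial>lborel)"
    by (subst nn_integral_add[symmetric]) (auto simp: distrib_left)
  also have "\<dots> = ennreal pi * (\<integral>\<^sup>+x. \<integral>\<^sup>+y. h x y \<partial>lborel \<partial>lborel)"
    by (subst half_plane_integral_opposite[OF assms]) (simp add: nn_integral_multc)
  finally show ?thesis .
qed

text \<open>At fixed \<open>p\<close> and \<open>\<theta>\<close>, the lines \<open>(p, \<theta>, t)\<close> sweep out the vertical plane over the common
  projection, and the shear \<open>t \<mapsto> t + s p\<close> preserves its area.\<close>

lemma nn_integral_vertical_plane:
  assumes [measurable]: "D \<in> sets borel"
  shows "(\<integral>\<^sup>+t. \<integral>\<^sup>+s. indicator D (line_curve (p, \<theta>, t) s) \<partial>lborel \<partial>lborel)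
       = (\<integral>\<^sup>+s. \<integral>\<^sup>+z. indicator D (p * cos \<theta> + s * sin \<theta>, p * sin \<theta> - s * cos \<theta>, z) \<partial>lborel \<partial>lborel)"
proof -
  have "(\<integral>\<^sup>+t. \<integral>\<^sup>+s. indicator D (line_curve (p, \<theta>, t) s) \<partial>lborel \<partial>lborel)
      = (\<integral>\<^sup>+s. \<integral>\<^sup>+t. indicator D (line_curve (p, \<theta>, t) s) \<partial>lborel \<partial>lborel)"
    by (rule lborel_pair.Fubini') measurable
  also have "\<dots> = (\<integral>\<^sup>+s. \<integral>\<^sup>+z. indicator D (p * cos \<theta> + s * sin \<theta>, p * sin \<theta> - s * cos \<theta>, z) \<partial>lborel \<partial>lborel)"
  proof (rule nn_integral_cong)
    fix s :: real
    show "(\<integral>\<^sup>+t. indicator D (line_curve (p, \<theta>, t) s) \<partial>lborel)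
        = (\<integral>\<^sup>+z. indicator D (p * cos \<theta> + s * sin \<theta>, p * sin \<theta> - s * cos \<theta>, z) \<partial>lborel)"
      by (subst (2) nn_integral_real_affine[where c = 1 and t = "s * p"])
        (auto simp: line_curve_def add.commute)
  qed
  finally show ?thesis .
qed

lemma nn_integral_lborel_triple:
  fixes f :: "real \<times> real \<times> real \<Rightarrow> ennreal"
  assumes [measurable]: "f \<in> borel_measurable borel"
  shows "(\<integral>\<^sup>+q. f q \<partial>lborel) = (\<integral>\<^sup>+x. \<integral>\<^sup>+y. \<integral>\<^sup>+z. f (x, y, z) \<partial>lborel \<partial>lborel \<partial>lborel)"
proof -
  have "(\<integral>\<^sup>+q. f q \<partial>lborel) = (\<integral>\<^sup>+x. \<integral>\<^sup>+w. f (x, w) \<partial>lborel \<partial>lborel)"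
    by (subst lborel_prod[symmetric], subst lborel.nn_integral_fst[symmetric])
       (simp_all add: lborel_prod)
  also have "\<dots> = (\<integral>\<^sup>+x. \<integral>\<^sup>+y. \<integral>\<^sup>+z. f (x, y, z) \<partial>lborel \<partial>lborel \<partial>lborel)"
    by (intro nn_integral_cong, subst lborel_prod[symmetric],
        subst lborel.nn_integral_fst[symmetric]) (simp_all add: lborel_prod)
  finally show ?thesis .
qed

lemma line_params_borel [measurable]: "line_params \<in> sets borel"
proof -
  have "line_params = {0..} \<times> {0..<2 * pi} \<times> UNIV" by (auto simp: line_params_def)
  also have "\<dots> \<in> sets borel" by (intro borel_Times) simp_all
  finally show ?thesis .
qed

lemma nn_integral_line_params:
  assumes [measurable]: "D \<in> sets borel"
  shows "(\<integral>\<^sup>+P. (\<integral>\<^sup>+s. indicator D (line_curve P s) \<partial>lborel) \<partial>restrict_space lborel line_params)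
       = ennreal pi * emeasure lborel D"
proof -
  define h where "h x y = (\<integral>\<^sup>+z. indicator D (x, y, z) \<partial>lborel)" for x y :: real
  have h [measurable]: "case_prod h \<in> borel_measurable (borel \<Otimes>\<^sub>M borel)"
    unfolding h_def by measurable
  have ind: "indicator line_params (p, \<theta>, t)
      = (indicator {0..} p * indicator {0..<2 * pi} \<theta> :: ennreal)" for p \<theta> t
    by (auto simp: line_params_def indicator_def)
  have "(\<integral>\<^sup>+P. (\<integral>\<^sup>+s. indicator D (line_curve P s) \<partial>lborel) \<partial>restrict_space lborel line_params)
      = (\<integral>\<^sup>+P. (\<integral>\<^sup>+s. indicator D (line_curve P s) \<partial>lborel) * indicator line_params P \<partial>lborel)"
    by (rule nn_integral_restrict_space) simp
  also have "\<dots> = (\<integral>\<^sup>+p. \<integral>\<^sup>+\<theta>. \<integral>\<^sup>+t. (\<integral>\<^sup>+s. indicator D (line_curve (p, \<theta>, t) s) \<partial>lborel)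
      * indicator line_params (p, \<theta>, t) \<partial>lborel \<partial>lborel \<partial>lborel)"
    by (rule nn_integral_lborel_triple) measurable
  also have "\<dots> = (\<integral>\<^sup>+p. \<integral>\<^sup>+\<theta>. indicator {0..<2 * pi} \<theta> * (indicator {0..} p *
      (\<integral>\<^sup>+s. h (p * cos \<theta> + s * sin \<theta>) (p * sin \<theta> - s * cos \<theta>) \<partial>lborel)) \<partial>lborel \<partial>lborel)"
    unfolding ind h_def nn_integral_vertical_plane[OF assms, symmetric]
    by (subst nn_integral_multc) (measurable, simp add: mult_ac)
  also have "\<dots> = (\<integral>\<^sup>+\<theta>. \<integral>\<^sup>+p. indicator {0..<2 * pi} \<theta> * (indicator {0..} p *
      (\<integral>\<^sup>+s. h (p * cos \<theta> + s * sin \<theta>) (p * sin \<theta> - s * cos \<theta>) \<partial>lborel)) \<partial>lborel \<partial>lborel)"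
    by (rule lborel_pair.Fubini') measurable
  also have "\<dots> = (\<integral>\<^sup>+\<theta>. indicator {0..<2 * pi} \<theta> * half_plane_integral h \<theta> \<partial>lborel)"
    unfolding half_plane_integral_def by (subst nn_integral_cmult) simp_all
  also have "\<dots> = ennreal pi * (\<integral>\<^sup>+x. \<integral>\<^sup>+y. h x y \<partial>lborel \<partial>lborel)"
    by (rule half_plane_integral_full_turn) (rule h)
  also have "(\<integral>\<^sup>+x. \<integral>\<^sup>+y. h x y \<partial>lborel \<partial>lborel) = emeasure lborel D"
    unfolding h_def using nn_integral_lborel_triple[of "indicator D"] by simp
  finally show ?thesis .
qed

theorem theorem1p2:
  fixes D :: "heis set"
  assumes "open D" and "convex D" and "D \<noteq> {}"
  shows "(\<integral>\<^sup>+G\<in>{G \<in> space line_density. range (oriented_line G) \<inter> D \<noteq> {}}.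
            chord_length D (oriented_line G) \<partial>line_density)
         = ennreal (2 * pi) * emeasure lborel D"
proof -
  let ?L = "restrict_space lborel line_params"
  let ?c = "\<lambda>P. \<integral>\<^sup>+s. indicator D (line_curve P s) \<partial>lborel"
  have D [measurable]: "D \<in> sets borel" using assms(1) by simp
  interpret L: sigma_finite_measure ?L
    by (rule sigma_finite_measure_restrict_space)
       (simp_all add: lborel.sigma_finite_measure_axioms)
  have [measurable]: "?c \<in> borel_measurable ?L"
    by (rule measurable_restrict_space1) measurable
  have "(\<integral>\<^sup>+G\<in>{G \<in> space line_density. range (oriented_line G) \<inter> D \<noteq> {}}.
            chord_length D (oriented_line G) \<partial>line_density)
      = (\<integral>\<^sup>+G. ?c (snd G) \<partial>line_density)"
  proof (intro nn_integral_cong)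
    fix G assume G: "G \<in> space line_density"
    then have "chord_length D (oriented_line G) = ?c (snd G)"
      using chord_length_oriented_line[OF D, of "fst G" "snd G"]
      by (auto simp: line_density_def space_pair_measure)
    moreover have "chord_length D (oriented_line G) = 0" if "range (oriented_line G) \<inter> D = {}"
      using that by (rule chord_length_eq_0_if_disjoint)
    ultimately show "chord_length D (oriented_line G) *
        indicator {G \<in> space line_density. range (oriented_line G) \<inter> D \<noteq> {}} G = ?c (snd G)"
      using G by (auto simp: indicator_def)
  qed
  also have "\<dots> = (\<integral>\<^sup>+\<epsilon>. \<integral>\<^sup>+P. ?c P \<partial>?L \<partial>count_space {1, -1 :: real})"
    unfolding line_density_def by (subst L.nn_integral_fst[symmetric]) simp_all
  also have "\<dots> = 2 * (ennreal pi * emeasure lborel D)"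
    unfolding nn_integral_line_params[OF D]
    by (subst nn_integral_count_space_finite) (simp_all add: mult_2)
  also have "\<dots> = ennreal (2 * pi) * emeasure lborel D"
    by (simp add: ennreal_mult mult.assoc)
  finally show ?thesis .
qed

end
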